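(* Let $T:A\to B$ be a CPTP map between finite-dimensional systems and let $d=|B|$. Then $T$ can be implemented by incoherent operations using the maximally coherent resource state $\Psi_d$: there exists an incoherent operation $\mathcal I:A\otimes\mathbb C^d\to B$ such that $\mathcal I\bigl(\rho\otimes|\Psi_d\rangle\langle\Psi_d|\bigr)=T(\rho)$ for every state $\rho$ on $A$.
   Context: All systems are finite-dimensional Hilbert spaces, each with a fixed orthonormal basis $\{|i\rangle\}$ (the incoherent basis); a tensor product of systems carries the product basis. $|B|$ denotes the dimension of $B$. A state is incoherent if its density matrix is diagonal in the incoherent basis. An operator $K$ between two systems is incoherent if $K\delta K^\dagger$ is diagonal in the incoherent basis for every incoherent state $\delta$. An incoherent operation is a CPTP map having a Kraus representation $\rho\mapsto\sum_\alpha K_\alpha\rho K_\alpha^\dagger$, $\sum_\alpha K_\alpha^\dagger K_\alpha=1$, with all $K_\alpha$ incoherent. The maximally coherent state on $\mathbb C^d$ is $|\Psi_d\rangle=\frac1{\sqrt d}\sum_{i=0}^{d-1}|i\rangle$. *)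

theory Defs
  imports "Jordan_Normal_Form.Schur_Decomposition"
begin

text \<open>
  A system of dimension \<open>n\<close> is the space of complex vectors of length \<open>n\<close>, its incoherent basis
  being the standard basis.  Operators and density matrices are matrices in that basis, and
  a map between systems of dimensions \<open>n\<close> and \<open>m\<close> is a function on matrices of which only the
  values on \<open>carrier_mat n n\<close> matter.
\<close>

definition mtrace :: "complex mat \<Rightarrow> complex" where
  "mtrace A = (\<Sum>i<dim_row A. A $$ (i, i))"

text \<open>
  The order on the complex numbers is the one of \<open>Complex_Order\<close>: \<open>0 \<le> z\<close> means that \<open>z\<close> is
  real and nonnegative. In particular, Hermiticity follows from the definition.
\<close>

definition positive_op :: "nat \<Rightarrow> complex mat \<Rightarrow> bool" where
  "positive_op n A \<longleftrightarrow>
     A \<in> carrier_mat n n \<and> (\<forall>v \<in> carrier_vec n. 0 \<le> (A *\<^sub>v v) \<bullet>c v)"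

definition state :: "nat \<Rightarrow> complex mat \<Rightarrow> bool" where
  "state n \<rho> \<longleftrightarrow> positive_op n \<rho> \<and> mtrace \<rho> = 1"

text \<open>
  The product basis vector \<open>|i> |j>\<close> of a system of dimension \<open>n\<close> tensored with one of
  dimension \<open>m\<close> has index \<open>i * m + j\<close>.
\<close>

definition kron :: "complex mat \<Rightarrow> complex mat \<Rightarrow> complex mat" where
  "kron A B = mat (dim_row A * dim_row B) (dim_col A * dim_col B)
     (\<lambda>(r, c). A $$ (r div dim_row B, c div dim_col B) * B $$ (r mod dim_row B, c mod dim_col B))"

text \<open>
  \<open>id_tensor k n m T\<close> is the map \<open>id \<otimes> T\<close>, where \<open>id\<close> acts on an ancilla of dimension \<open>k\<close> and \<open>T\<close>
  maps dimension \<open>n\<close> to dimension \<open>m\<close>: it applies \<open>T\<close> to each of the \<open>k * k\<close> blocks of size \<open>n\<close>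
  (its values on product operators are computed in \<open>id_tensor_kron\<close>).
\<close>

definition block :: "nat \<Rightarrow> complex mat \<Rightarrow> nat \<Rightarrow> nat \<Rightarrow> complex mat" where
  "block n X i j = mat n n (\<lambda>(a, b). X $$ (i * n + a, j * n + b))"

definition id_tensor ::
    "nat \<Rightarrow> nat \<Rightarrow> nat \<Rightarrow> (complex mat \<Rightarrow> complex mat) \<Rightarrow> complex mat \<Rightarrow> complex mat" where
  "id_tensor k n m T X = mat (k * m) (k * m)
     (\<lambda>(r, c). T (block n X (r div m) (c div m)) $$ (r mod m, c mod m))"

definition linear_op :: "nat \<Rightarrow> nat \<Rightarrow> (complex mat \<Rightarrow> complex mat) \<Rightarrow> bool" where
  "linear_op n m T \<longleftrightarrow>
     (\<forall>X \<in> carrier_mat n n. T X \<in> carrier_mat m m) \<and>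
     (\<forall>X \<in> carrier_mat n n. \<forall>Y \<in> carrier_mat n n. T (X + Y) = T X + T Y) \<and>
     (\<forall>c. \<forall>X \<in> carrier_mat n n. T (c \<cdot>\<^sub>m X) = c \<cdot>\<^sub>m T X)"

lemma id_tensor_kron:
  assumes T: "linear_op n m T" and X: "X \<in> carrier_mat k k" and Y: "Y \<in> carrier_mat n n"
  shows "id_tensor k n m T (kron X Y) = kron X (T Y)"
proof -
  have TY: "T Y \<in> carrier_mat m m" using T Y by (auto simp: linear_op_def)
  have lt: "i * n + a < k * n" if "i < k" "a < n" for i a :: nat
  proof -
    have "i * n + a < Suc i * n" using that by simp
    also have "\<dots> \<le> k * n" using that by (intro mult_right_mono) auto
    finally show ?thesis .
  qed
  have bl: "block n (kron X Y) i j = X $$ (i, j) \<cdot>\<^sub>m Y" if "i < k" "j < k" for i j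
    using that X Y lt by (intro eq_matI) (auto simp: block_def kron_def)
  show ?thesis
  proof (rule eq_matI)
    fix r c assume rc: "r < dim_row (kron X (T Y))" "c < dim_col (kron X (T Y))"
    then have rc': "r < k * m" "c < k * m" using X TY by (auto simp: kron_def)
    then have m: "m > 0" by (cases m) auto
    have d: "r div m < k" "c div m < k" using rc' by (auto simp: less_mult_imp_div_less)
    have "T (X $$ (r div m, c div m) \<cdot>\<^sub>m Y) = X $$ (r div m, c div m) \<cdot>\<^sub>m T Y"
      using T Y by (auto simp: linear_op_def)
    moreover have "id_tensor k n m T (kron X Y) $$ (r, c) =
        T (X $$ (r div m, c div m) \<cdot>\<^sub>m Y) $$ (r mod m, c mod m)"
      using rc' d by (simp add: id_tensor_def bl)
    ultimately show "id_tensor k n m T (kron X Y) $$ (r, c) = kron X (T Y) $$ (r, c)"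
      using rc' m X TY by (simp add: kron_def)
  qed (use X TY in \<open>auto simp: id_tensor_def kron_def\<close>)
qed

definition completely_positive :: "nat \<Rightarrow> nat \<Rightarrow> (complex mat \<Rightarrow> complex mat) \<Rightarrow> bool" where
  "completely_positive n m T \<longleftrightarrow>
     (\<forall>k X. positive_op (k * n) X \<longrightarrow> positive_op (k * m) (id_tensor k n m T X))"

definition trace_preserving :: "nat \<Rightarrow> (complex mat \<Rightarrow> complex mat) \<Rightarrow> bool" where
  "trace_preserving n T \<longleftrightarrow> (\<forall>X \<in> carrier_mat n n. mtrace (T X) = mtrace X)"

definition cptp :: "nat \<Rightarrow> nat \<Rightarrow> (complex mat \<Rightarrow> complex mat) \<Rightarrow> bool" where
  "cptp n m T \<longleftrightarrow> linear_op n m T \<and> completely_positive n m T \<and> trace_preserving n T"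

definition incoherent_state :: "nat \<Rightarrow> complex mat \<Rightarrow> bool" where
  "incoherent_state n \<delta> \<longleftrightarrow> state n \<delta> \<and> diagonal_mat \<delta>"

definition incoherent_operator :: "nat \<Rightarrow> nat \<Rightarrow> complex mat \<Rightarrow> bool" where
  "incoherent_operator n m K \<longleftrightarrow>
     K \<in> carrier_mat m n \<and> (\<forall>\<delta>. incoherent_state n \<delta> \<longrightarrow> diagonal_mat (K * \<delta> * mat_adjoint K))"

text \<open>Sum of \<open>r\<close> matrices of size \<open>n\<close>; the matrix type has no size-independent zero.\<close>

definition mat_sum :: "nat \<Rightarrow> nat \<Rightarrow> (nat \<Rightarrow> complex mat) \<Rightarrow> complex mat" where
  "mat_sum n r F = mat n n (\<lambda>(i, j). \<Sum>\<alpha><r. F \<alpha> $$ (i, j))"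

definition kraus_rep ::
    "nat \<Rightarrow> nat \<Rightarrow> nat \<Rightarrow> (nat \<Rightarrow> complex mat) \<Rightarrow> (complex mat \<Rightarrow> complex mat) \<Rightarrow> bool" where
  "kraus_rep n m r K T \<longleftrightarrow>
     (\<forall>\<alpha><r. K \<alpha> \<in> carrier_mat m n) \<and>
     mat_sum n r (\<lambda>\<alpha>. mat_adjoint (K \<alpha>) * K \<alpha>) = 1\<^sub>m n \<and>
     (\<forall>\<rho> \<in> carrier_mat n n. T \<rho> = mat_sum m r (\<lambda>\<alpha>. K \<alpha> * \<rho> * mat_adjoint (K \<alpha>)))"

definition incoherent_operation :: "nat \<Rightarrow> nat \<Rightarrow> (complex mat \<Rightarrow> complex mat) \<Rightarrow> bool" where
  "incoherent_operation n m T \<longleftrightarrow>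
     cptp n m T \<and> (\<exists>r K. kraus_rep n m r K T \<and> (\<forall>\<alpha><r. incoherent_operator n m (K \<alpha>)))"

definition max_coherent :: "nat \<Rightarrow> complex vec" where
  "max_coherent d = vec d (\<lambda>i. 1 / complex_of_real (sqrt (real d)))"

definition projector :: "complex vec \<Rightarrow> complex mat" where
  "projector v = mat (dim_vec v) (dim_vec v) (\<lambda>(i, j). v $ i * cnj (v $ j))"

end

(*
  Let K_alpha be Kraus operators of T and put, for k < d,
    M_(alpha,k) = sum_j |j> (<j| K_alpha) (x) <j + k mod d|.
  Each M_(alpha,k) maps every basis vector to a multiple of a basis vector, hence is
  incoherent.  Applied to psi (x) Psi_d it gives K_alpha psi / sqrt d, so summing over the d
  shifts k recovers T.  The shifts are what makes the family complete:
  sum_k |j + k><j + k| = 1 for each j, so the M^* M sum to (sum_alpha K_alpha^* K_alpha) (x) 1.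
*)

theory Submission
  imports Defs
begin

section \<open>Finite sums over product indices\<close>

lemma mult_add_less_mult:
  fixes i p k n :: nat
  assumes "i < k" "p < n"
  shows "i * n + p < k * n"
proof -
  have "i * n + p < Suc i * n" using assms by simp
  also have "\<dots> \<le> k * n" using assms by (intro mult_right_mono) auto
  finally show ?thesis .
qed

text \<open>The product basis vector of \<open>i\<close> and \<open>p\<close> has index
  \<open>i * n + p\<close>, so this splits a sum over the basis of a tensor product into sums over
  the bases of its factors.\<close>

lemma sum_lessThan_mult:
  fixes g :: "nat \<Rightarrow> 'a::comm_monoid_add"
  shows "(\<Sum>x<k*n. g x) = (\<Sum>i<k. \<Sum>p<n. g (i * n + p))"
proof -
  have "(\<Sum>x<k*n. g x) = (\<Sum>(i, p)\<in>{..<k} \<times> {..<n}. g (i * n + p))"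
    by (rule sum.reindex_bij_witness[where i = "\<lambda>(i, p). i * n + p" and j = "\<lambda>x. (x div n, x mod n)"])
      (auto simp: mult_add_less_mult less_mult_imp_div_less intro!: mod_less_divisor gr0I)
  then show ?thesis by (simp add: sum.cartesian_product)
qed

lemma sum_swap4:
  "(\<Sum>x\<in>A. \<Sum>y\<in>B. \<Sum>r\<in>C. \<Sum>c\<in>D. f x y r c) = (\<Sum>r\<in>C. \<Sum>c\<in>D. \<Sum>x\<in>A. \<Sum>y\<in>B. f x y r c)"
proof -
  have "(\<Sum>x\<in>A. \<Sum>y\<in>B. \<Sum>r\<in>C. \<Sum>c\<in>D. f x y r c) =
      (\<Sum>(x, y)\<in>A \<times> B. \<Sum>(r, c)\<in>C \<times> D. f x y r c)"
    by (simp flip: sum.cartesian_product)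
  also have "\<dots> = (\<Sum>(r, c)\<in>C \<times> D. \<Sum>(x, y)\<in>A \<times> B. f x y r c)"
    unfolding case_prod_beta by (rule sum.swap)
  finally show ?thesis by (simp flip: sum.cartesian_product)
qed

subsection \<open>Positive semidefinite kernels\<close>

text \<open>Kernels and vectors are functions of which only the values below \<open>n\<close>
  matter, so that passing to a leading submatrix only changes \<open>n\<close> and no carrier
  conditions arise.\<close>

definition psd :: "nat \<Rightarrow> (nat \<Rightarrow> nat \<Rightarrow> complex) \<Rightarrow> bool" where
  "psd n A \<longleftrightarrow> (\<forall>v. 0 \<le> (\<Sum>i<n. \<Sum>j<n. cnj (v i) * A i j * v j))"

lemma positive_op_iff_psd:
  "positive_op n X \<longleftrightarrow> X \<in> carrier_mat n n \<and> psd n (\<lambda>i j. X $$ (i, j))"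
proof (cases "X \<in> carrier_mat n n")
  case True
  have form: "(X *\<^sub>v v) \<bullet>c v = (\<Sum>i<n. \<Sum>j<n. cnj (v $ i) * X $$ (i, j) * v $ j)"
    if "v \<in> carrier_vec n" for v
  proof -
    have "(X *\<^sub>v v) \<bullet>c v = (\<Sum>i<n. (\<Sum>j<n. X $$ (i, j) * v $ j) * cnj (v $ i))"
      using True that
      by (auto simp: scalar_prod_def atLeast0LessThan intro!: sum.cong)
    then show ?thesis
      by (simp add: sum_distrib_right) (simp add: mult_ac)
  qed
  have "psd n (\<lambda>i j. X $$ (i, j))" if "positive_op n X"
    unfolding psd_def
  proof
    fix v :: "nat \<Rightarrow> complex"
    have "0 \<le> (X *\<^sub>v vec n v) \<bullet>c vec n v"
      using that by (simp add: positive_op_def)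
    then show "0 \<le> (\<Sum>i<n. \<Sum>j<n. cnj (v i) * X $$ (i, j) * v j)"
      by (simp add: form)
  qed
  moreover have "positive_op n X" if "psd n (\<lambda>i j. X $$ (i, j))"
    unfolding positive_op_def
  proof (intro conjI ballI)
    fix v :: "complex vec" assume "v \<in> carrier_vec n"
    then show "0 \<le> (X *\<^sub>v v) \<bullet>c v"
      using that[unfolded psd_def, rule_format, of "\<lambda>i. v $ i"] form by simp
  qed (use True in auto)
  ultimately show ?thesis using True by blast
qed (auto simp: positive_op_def)

lemma psd_sum:
  assumes "\<And>\<alpha>. \<alpha> \<in> S \<Longrightarrow> psd n (A \<alpha>)"
  shows "psd n (\<lambda>i j. \<Sum>\<alpha>\<in>S. A \<alpha> i j)"
  unfolding psd_def
proof
  fix v :: "nat \<Rightarrow> complex"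
  have "(\<Sum>i<n. \<Sum>j<n. cnj (v i) * (\<Sum>\<alpha>\<in>S. A \<alpha> i j) * v j) =
      (\<Sum>i<n. \<Sum>j<n. \<Sum>\<alpha>\<in>S. cnj (v i) * A \<alpha> i j * v j)"
    by (simp add: sum_distrib_left sum_distrib_right)
  also have "\<dots> = (\<Sum>\<alpha>\<in>S. \<Sum>i<n. \<Sum>j<n. cnj (v i) * A \<alpha> i j * v j)"
    by (simp add: sum.swap[of _ S])
  also have "0 \<le> \<dots>" using assms by (intro sum_nonneg[of S]) (simp add: psd_def)
  finally show "0 \<le> (\<Sum>i<n. \<Sum>j<n. cnj (v i) * (\<Sum>\<alpha>\<in>S. A \<alpha> i j) * v j)" .
qed

text \<open>The form of the new kernel at \<open>v\<close> is the form of \<open>A\<close> at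
  \<open>w\<close>, the adjoint of \<open>L\<close> applied to \<open>v\<close>.\<close>

lemma psd_congruence:
  assumes "psd n A"
  shows "psd m (\<lambda>r c. \<Sum>x<n. \<Sum>y<n. L r x * A x y * cnj (L c y))"
  unfolding psd_def
proof
  fix v :: "nat \<Rightarrow> complex"
  define w where "w x = (\<Sum>r<m. cnj (L r x) * v r)" for x
  have "(\<Sum>r<m. \<Sum>c<m. cnj (v r) * (\<Sum>x<n. \<Sum>y<n. L r x * A x y * cnj (L c y)) * v c) =
      (\<Sum>r<m. \<Sum>c<m. \<Sum>x<n. \<Sum>y<n. cnj (v r) * (L r x * A x y * cnj (L c y)) * v c)"
    by (simp add: sum_distrib_left sum_distrib_right)
  also have "\<dots> = (\<Sum>x<n. \<Sum>y<n. \<Sum>r<m. \<Sum>c<m. cnj (v r) * (L r x * A x y * cnj (L c y)) * v c)"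
    by (rule sum_swap4)
  also have "\<dots> = (\<Sum>x<n. \<Sum>y<n. cnj (w x) * A x y * w y)"
    by (simp add: w_def sum_distrib_left sum_distrib_right mult_ac)
  also have "0 \<le> \<dots>" using assms by (simp add: psd_def)
  finally show "0 \<le> (\<Sum>r<m. \<Sum>c<m. cnj (v r) * (\<Sum>x<n. \<Sum>y<n. L r x * A x y * cnj (L c y)) * v c)" .
qed

lemma psd_diag:
  assumes "psd n A" "i < n"
  shows "0 \<le> A i i"
proof -
  have "0 \<le> (\<Sum>k<n. \<Sum>l<n. cnj (if k = i then 1 else 0) * A k l * (if l = i then 1 else 0))"
    by (rule assms(1)[unfolded psd_def, rule_format, of "\<lambda>k. if k = i then 1 else 0"])
  also have "\<dots> = (\<Sum>k<n. if k = i then (\<Sum>l<n. if l = i then A k l else 0) else 0)"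
    by (simp add: if_distrib[of "(*) _"] if_distrib[of cnj] if_distrib[of "\<lambda>x. x * _"] cong: if_cong)
  finally show ?thesis using assms(2) by simp
qed

text \<open>This is the form at the vector with entry 1 at \<open>i\<close>, entry \<open>t\<close>
  at \<open>j\<close> and 0 elsewhere.\<close>

lemma psd_two:
  assumes "psd n A" "i < n" "j < n" "i \<noteq> j"
  shows "0 \<le> A i i + t * A i j + cnj t * A j i + cnj t * t * A j j"
proof -
  define v where "v k = (if k = i then 1 else if k = j then t else 0)" for k
  have S: "(\<Sum>k<n. g k) = g i + g j" if "\<And>k. k \<noteq> i \<Longrightarrow> k \<noteq> j \<Longrightarrow> g k = 0" for g :: "nat \<Rightarrow> complex"
  proof -
    have "(\<Sum>k<n. g k) = (\<Sum>k\<in>{i, j}. g k)"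
      using assms that by (intro sum.mono_neutral_right) auto
    then show ?thesis using assms by simp
  qed
  have "0 \<le> (\<Sum>k<n. \<Sum>l<n. cnj (v k) * A k l * v l)"
    using assms unfolding psd_def by blast
  also have "\<dots> = (\<Sum>k<n. cnj (v k) * A k i * v i + cnj (v k) * A k j * v j)"
    by (intro sum.cong refl S) (auto simp: v_def)
  also have "\<dots> = (cnj (v i) * A i i * v i + cnj (v i) * A i j * v j) +
      (cnj (v j) * A j i * v i + cnj (v j) * A j j * v j)"
    by (intro S) (auto simp: v_def)
  finally show ?thesis using assms(4) by (simp add: v_def algebra_simps)
qed

text \<open>Polarisation: as the form is real, \<open>t = 1\<close> shows that
  \<open>A i j + A j i\<close> is real and \<open>t = \<i>\<close> that \<open>A i j - A j i\<close>
  is imaginary.\<close>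

lemma psd_hermitian:
  assumes "psd n A" "i < n" "j < n"
  shows "A j i = cnj (A i j)"
proof (cases "i = j")
  case True
  then show ?thesis using psd_diag[OF assms(1,2)]
    by (simp add: complex_eq_iff less_eq_complex_def)
next
  case False
  note d = psd_diag[OF assms(1,2)] psd_diag[OF assms(1,3)]
  show ?thesis
    using d psd_two[OF assms False, of 1] psd_two[OF assms False, of \<i>]
    by (simp add: complex_eq_iff less_eq_complex_def)
qed

text \<open>Without the term quadratic in \<open>t\<close>, the form of \<open>psd_two\<close> is
  real-affine in \<open>t\<close>; being bounded below, it is constant.\<close>

lemma psd_zero_diag:
  assumes "psd n A" "i < n" "j < n" "A j j = 0"
  shows "A i j = 0"
proof (cases "i = j")
  case False
  define z where "z = A i j"
  define N where "N = (Re z)\<^sup>2 + (Im z)\<^sup>2"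
  have h: "A j i = cnj z" using psd_hermitian[OF assms(1-3)] by (simp add: z_def)
  \<comment> \<open>This \<open>t\<close> aligns the phases: both cross terms become
    \<open>- s * N\<close>, where \<open>N\<close> is the squared modulus of
    \<open>z\<close>.\<close>
  have le: "2 * s * N \<le> Re (A i i)" for s :: real
    using psd_two[OF assms(1-3) False, of "- (of_real s * cnj z)"] assms(4)
    by (simp add: h flip: z_def)
      (simp add: less_eq_complex_def N_def power2_eq_square algebra_simps)
  have "N = 0"
  proof (rule ccontr)
    assume "N \<noteq> 0"
    \<comment> \<open>At this \<open>s\<close> the left side of \<open>le\<close> is
      \<open>Re (A i i) + 1\<close>.\<close>
    then show False using le[of "(Re (A i i) + 1) / (2 * N)"] by simp
  qed
  then show ?thesis
    by (simp add: z_def N_def complex_eq_iff sum_power2_eq_zero_iff)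
qed (use assms in simp)

text \<open>Cholesky factorisation: the last index is removed by passing to the Schur complement.\<close>

lemma psd_factor:
  assumes "psd n A"
  shows "\<exists>w :: nat \<Rightarrow> nat \<Rightarrow> complex. \<forall>i<n. \<forall>j<n. A i j = (\<Sum>k<n. w k i * cnj (w k j))"
  using assms
proof (induction n arbitrary: A)
  case (Suc n A)
  define p where "p = A n n"
  \<comment> \<open>The Schur complement of the last diagonal entry. If \<open>p = 0\<close>, the
    quotient is 0 and \<open>A'\<close> is \<open>A\<close>, whose last row and column then vanish
    by \<open>zero\<close>.\<close>
  define A' where "A' i j = A i j - A i n * A n j / p" for i j
  have p: "0 \<le> p" unfolding p_def using Suc.prems by (rule psd_diag) simp
  have herm: "A n i = cnj (A i n)" if "i \<le> n" for i
    using psd_hermitian[OF Suc.prems, of i n] that by simp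
  have zero: "A i n = 0" "A n i = 0" if "p = 0" "i \<le> n" for i
  proof -
    show "A i n = 0" using psd_zero_diag[OF Suc.prems, of i n] that by (simp add: p_def)
    then show "A n i = 0" using herm that by simp
  qed
  have "psd n A'"
    unfolding psd_def
  proof
    fix v :: "nat \<Rightarrow> complex"
    define b where "b = (\<Sum>j<n. A n j * v j)"
    \<comment> \<open>The last coordinate completes the square, so that the form of \<open>A\<close>
      at \<open>u\<close> is the form of \<open>A'\<close> at \<open>v\<close>. It is 0 if
      \<open>p = 0\<close>.\<close>
    define u where "u = v(n := - b / p)"
    have u: "u i = v i" if "i < n" for i using that by (simp add: u_def)
    have cb: "(\<Sum>i<n. cnj (v i) * A i n) = cnj b"
      by (simp add: b_def herm mult.commute)
    have b0: "b = 0" if "p = 0" using zero that by (simp add: b_def)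
    have cp: "cnj p = p" using p by (simp add: complex_eq_iff less_eq_complex_def)
    have "0 \<le> (\<Sum>i<Suc n. \<Sum>j<Suc n. cnj (u i) * A i j * u j)"
      using Suc.prems unfolding psd_def by blast
    also have "\<dots> = (\<Sum>i<n. \<Sum>j<n. cnj (v i) * A i j * v j) +
        (\<Sum>i<n. cnj (v i) * A i n) * u n + cnj (u n) * b + cnj (u n) * p * u n"
      by (simp add: u b_def sum.distrib sum_distrib_left sum_distrib_right mult_ac flip: p_def)
    also have "\<dots> = (\<Sum>i<n. \<Sum>j<n. cnj (v i) * A i j * v j) - cnj b * b / p"
      unfolding cb using b0 cp by (cases "p = 0") (simp_all add: u_def field_simps)
    also have "cnj b * b / p = (\<Sum>i<n. \<Sum>j<n. cnj (v i) * (A i n * A n j / p) * v j)"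
      unfolding cb[symmetric] unfolding b_def sum_product sum_divide_distrib
      by (simp add: mult_ac)
    finally show "0 \<le> (\<Sum>i<n. \<Sum>j<n. cnj (v i) * A' i j * v j)"
      by (simp add: A'_def algebra_simps sum_subtractf)
  qed
  then obtain w where w: "\<And>i j. i < n \<Longrightarrow> j < n \<Longrightarrow> A' i j = (\<Sum>k<n. w k i * cnj (w k j))"
    using Suc.IH by blast
  define s where "s = complex_of_real (sqrt (Re p))"
  have s: "s * s = p" "cnj s = s"
    using p by (simp_all add: s_def complex_eq_iff less_eq_complex_def flip: of_real_mult)
  \<comment> \<open>The new vector, the last column over the root of \<open>p\<close>, contributes
    exactly the term subtracted in \<open>A'\<close>; the old vectors are padded with 0 at index
    \<open>n\<close>. If \<open>p = 0\<close>, the new vector is 0.\<close>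
  define w' where "w' k i = (if k = n then A i n / s else if i = n then 0 else w k i)" for k i
  have "A i j = (\<Sum>k<Suc n. w' k i * cnj (w' k j))" if ij: "i < Suc n" "j < Suc n" for i j
  proof -
    have "w' n i * cnj (w' n j) = A i n * A n j / p"
      using ij by (simp add: w'_def s herm flip: s(1))
    moreover have "(\<Sum>k<n. w' k i * cnj (w' k j)) = A i j - A i n * A n j / p"
    proof (cases "i = n \<or> j = n")
      case True
      then have "(\<Sum>k<n. w' k i * cnj (w' k j)) = 0"
        by (intro sum.neutral) (auto simp: w'_def)
      moreover have "A i j = A i n * A n j / p"
      proof (cases "p = 0")
        case p0: True
        have "A i n = 0" "A n j = 0" using zero[OF p0] ij by simp_all
        then show ?thesis using True by auto
      next
        case False
        then show ?thesis using True by (auto simp flip: p_def)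
      qed
      ultimately show ?thesis by simp
    next
      case False
      then have "(\<Sum>k<n. w' k i * cnj (w' k j)) = (\<Sum>k<n. w k i * cnj (w k j))"
        by (intro sum.cong) (auto simp: w'_def)
      then show ?thesis using w[of i j] False ij by (simp add: A'_def)
    qed
    ultimately show ?thesis by simp
  qed
  then show ?case by blast
qed simp

subsection \<open>Kraus representations\<close>

lemma mat_adjoint_dim [simp]:
  "dim_row (mat_adjoint A) = dim_col A" "dim_col (mat_adjoint A) = dim_row A"
  by (simp_all add: mat_adjoint_def)

lemma mat_adjoint_index [simp]:
  fixes A :: "complex mat"
  assumes "i < dim_col A" "j < dim_row A"
  shows "mat_adjoint A $$ (i, j) = cnj (A $$ (j, i))"
  using assms by (simp add: mat_adjoint_def mat_of_rows_index)

lemma sandwich_index: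
  fixes K X :: "complex mat"
  assumes "K \<in> carrier_mat m n" "X \<in> carrier_mat n n" "b < m" "c < m"
  shows "(K * X * mat_adjoint K) $$ (b, c) =
    (\<Sum>i<n. \<Sum>j<n. K $$ (b, i) * X $$ (i, j) * cnj (K $$ (c, j)))"
proof -
  have "(K * X * mat_adjoint K) $$ (b, c) =
      (\<Sum>j<n. (\<Sum>i<n. K $$ (b, i) * X $$ (i, j)) * cnj (K $$ (c, j)))"
    using assms by (simp add: scalar_prod_def atLeast0LessThan)
  also have "\<dots> = (\<Sum>j<n. \<Sum>i<n. K $$ (b, i) * X $$ (i, j) * cnj (K $$ (c, j)))"
    by (simp add: sum_distrib_right)
  finally show ?thesis by (subst sum.swap)
qed

lemma adjoint_mult_index:
  fixes K :: "complex mat"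
  assumes "K \<in> carrier_mat m n" "i < n" "j < n"
  shows "(mat_adjoint K * K) $$ (i, j) = (\<Sum>b<m. cnj (K $$ (b, i)) * K $$ (b, j))"
  using assms by (simp add: scalar_prod_def atLeast0LessThan)

text \<open>Reading the matrix identities entry by entry turns the later arguments into
  manipulations of finite sums.\<close>

lemma kraus_rep_iff:
  "kraus_rep n m r K T \<longleftrightarrow>
     (\<forall>\<alpha><r. K \<alpha> \<in> carrier_mat m n) \<and>
     (\<forall>i<n. \<forall>j<n. (\<Sum>\<alpha><r. \<Sum>b<m. cnj (K \<alpha> $$ (b, i)) * K \<alpha> $$ (b, j)) = (if i = j then 1 else 0)) \<and>
     (\<forall>X \<in> carrier_mat n n. T X \<in> carrier_mat m m \<and>
       (\<forall>b<m. \<forall>c<m. T X $$ (b, c) =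
         (\<Sum>\<alpha><r. \<Sum>i<n. \<Sum>j<n. K \<alpha> $$ (b, i) * X $$ (i, j) * cnj (K \<alpha> $$ (c, j)))))"
proof (cases "\<forall>\<alpha><r. K \<alpha> \<in> carrier_mat m n")
  case True
  have "mat_sum n r (\<lambda>\<alpha>. mat_adjoint (K \<alpha>) * K \<alpha>) = 1\<^sub>m n \<longleftrightarrow>
      (\<forall>i<n. \<forall>j<n. (\<Sum>\<alpha><r. \<Sum>b<m. cnj (K \<alpha> $$ (b, i)) * K \<alpha> $$ (b, j)) = (if i = j then 1 else 0))"
    using True by (simp add: mat_eq_iff mat_sum_def adjoint_mult_index[where m = m and n = n] del: index_mult_mat)
  moreover have "T X = mat_sum m r (\<lambda>\<alpha>. K \<alpha> * X * mat_adjoint (K \<alpha>)) \<longleftrightarrow>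
      T X \<in> carrier_mat m m \<and> (\<forall>b<m. \<forall>c<m. T X $$ (b, c) =
         (\<Sum>\<alpha><r. \<Sum>i<n. \<Sum>j<n. K \<alpha> $$ (b, i) * X $$ (i, j) * cnj (K \<alpha> $$ (c, j))))"
    if "X \<in> carrier_mat n n" for X
    using True that
    by (auto simp: mat_eq_iff mat_sum_def sandwich_index[where m = m and n = n] simp del: index_mult_mat)
  ultimately show ?thesis
    using True by (simp add: kraus_rep_def)
qed (auto simp: kraus_rep_def)

section \<open>Maps with a Kraus representation are CPTP\<close>

lemma kraus_rep_linear_op:
  assumes "kraus_rep n m r K T"
  shows "linear_op n m T"
proof -
  have carr: "T X \<in> carrier_mat m m" if "X \<in> carrier_mat n n" for X
    using assms that by (simp add: kraus_rep_iff)
  have entry: "T X $$ (b, c) =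
      (\<Sum>\<alpha><r. \<Sum>i<n. \<Sum>j<n. K \<alpha> $$ (b, i) * X $$ (i, j) * cnj (K \<alpha> $$ (c, j)))"
    if "X \<in> carrier_mat n n" "b < m" "c < m" for X b c
    using assms that by (simp add: kraus_rep_iff)
  have "T (X + Y) = T X + T Y" if X: "X \<in> carrier_mat n n" and Y: "Y \<in> carrier_mat n n" for X Y
    using X Y carr[OF X] carr[OF Y] carr[of "X + Y"]
    by (intro eq_matI) (auto simp: entry sum.distrib algebra_simps)
  moreover have "T (z \<cdot>\<^sub>m X) = z \<cdot>\<^sub>m T X" if X: "X \<in> carrier_mat n n" for z X
    using X carr[OF X] carr[of "z \<cdot>\<^sub>m X"]
    by (intro eq_matI) (auto simp: entry sum_distrib_left mult_ac)
  ultimately show ?thesis using carr by (simp add: linear_op_def)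
qed

text \<open>Cyclicity of the trace in coordinates: once the sums are exchanged, \<open>X\<close> is
  paired with the completeness sum, which is the identity.\<close>

lemma kraus_rep_trace_preserving:
  assumes "kraus_rep n m r K T"
  shows "trace_preserving n T"
  unfolding trace_preserving_def
proof
  fix X :: "complex mat" assume X: "X \<in> carrier_mat n n"
  have "mtrace (T X) =
      (\<Sum>b<m. \<Sum>\<alpha><r. \<Sum>i<n. \<Sum>j<n. K \<alpha> $$ (b, i) * X $$ (i, j) * cnj (K \<alpha> $$ (b, j)))"
    using assms X by (auto simp: mtrace_def kraus_rep_iff)
  also have "\<dots> = (\<Sum>i<n. \<Sum>j<n. \<Sum>b<m. \<Sum>\<alpha><r. K \<alpha> $$ (b, i) * X $$ (i, j) * cnj (K \<alpha> $$ (b, j)))"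
    by (rule sum_swap4)
  also have "\<dots> = (\<Sum>i<n. \<Sum>j<n. X $$ (i, j) * (\<Sum>\<alpha><r. \<Sum>b<m. cnj (K \<alpha> $$ (b, j)) * K \<alpha> $$ (b, i)))"
    by (subst sum.swap[of _ "{..<r}"]) (simp add: sum_distrib_left mult_ac)
  also have "\<dots> = (\<Sum>i<n. \<Sum>j<n. X $$ (i, j) * (if j = i then 1 else 0))"
    using assms by (intro sum.cong) (auto simp: kraus_rep_iff)
  also have "\<dots> = mtrace X"
    using X by (simp add: mtrace_def if_distrib[of "(*) _"] cong: if_cong)
  finally show "mtrace (T X) = mtrace X" .
qed

text \<open>With an ancilla the Kraus operators become 1 (x) K_alpha, so the image of
  \<open>X\<close> is a sum of congruences of \<open>X\<close>.\<close>

lemma kraus_rep_completely_positive: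
  assumes K: "kraus_rep n m r K T"
  shows "completely_positive n m T"
  unfolding completely_positive_def
proof (intro allI impI)
  fix k X assume "positive_op (k * n) X"
  then have X: "psd (k * n) (\<lambda>x y. X $$ (x, y))"
    by (simp add: positive_op_iff_psd)
  \<comment> \<open>\<open>L \<alpha>\<close> is 1 (x) \<open>K \<alpha>\<close> in the product
    basis: block diagonal with copies of \<open>K \<alpha>\<close>.\<close>
  define L where
    "L \<alpha> s x = (if x div n = s div m then K \<alpha> $$ (s mod m, x mod n) else 0)" for \<alpha> s x
  have block_sum: "(\<Sum>x<k*n. L \<alpha> s x * g x) =
      (\<Sum>p<n. K \<alpha> $$ (s mod m, p) * g (s div m * n + p))"
    if "s < k * m" for \<alpha> s g
  proof -
    have "s div m < k" using that by (simp add: less_mult_imp_div_less)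
    have "(\<Sum>x<k*n. L \<alpha> s x * g x) =
        (\<Sum>i<k. if i = s div m then (\<Sum>p<n. K \<alpha> $$ (s mod m, p) * g (i * n + p)) else 0)"
      unfolding sum_lessThan_mult by (intro sum.cong) (auto simp: L_def)
    then show ?thesis using \<open>s div m < k\<close> by simp
  qed
  have "id_tensor k n m T X $$ (s, t) =
      (\<Sum>\<alpha><r. \<Sum>x<k*n. \<Sum>y<k*n. L \<alpha> s x * X $$ (x, y) * cnj (L \<alpha> t y))"
    if st: "s < k * m" "t < k * m" for s t
  proof -
    have m: "m > 0" using st by (cases m) auto
    \<comment> \<open>The inner sum is written as a conjugate so that \<open>block_sum\<close>
      applies to it as well as to the outer sum.\<close>
    have "(\<Sum>x<k*n. \<Sum>y<k*n. L \<alpha> s x * X $$ (x, y) * cnj (L \<alpha> t y)) =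
        (\<Sum>x<k*n. L \<alpha> s x * cnj (\<Sum>y<k*n. L \<alpha> t y * cnj (X $$ (x, y))))" for \<alpha>
      by (simp add: sum_distrib_left mult_ac)
    also have "\<dots> \<alpha> = (\<Sum>p<n. \<Sum>q<n. K \<alpha> $$ (s mod m, p) * X $$ (s div m * n + p, t div m * n + q) *
        cnj (K \<alpha> $$ (t mod m, q)))" for \<alpha>
      by (simp only: block_sum[OF st(1)] block_sum[OF st(2)]) (simp add: sum_distrib_left mult_ac)
    finally show ?thesis
      using st K m by (simp add: id_tensor_def kraus_rep_iff block_def)
  qed
  then have "psd (k * m) (\<lambda>s t. id_tensor k n m T X $$ (s, t)) \<longleftrightarrow>
      psd (k * m) (\<lambda>s t. \<Sum>\<alpha><r. \<Sum>x<k*n. \<Sum>y<k*n. L \<alpha> s x * X $$ (x, y) * cnj (L \<alpha> t y))"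
    by (simp add: psd_def)
  also have \<dots> by (intro psd_sum psd_congruence X)
  finally show "positive_op (k * m) (id_tensor k n m T X)"
    by (simp add: positive_op_iff_psd id_tensor_def)
qed

lemma kraus_rep_cptp: "kraus_rep n m r K T \<Longrightarrow> cptp n m T"
  by (simp add: cptp_def kraus_rep_linear_op kraus_rep_trace_preserving kraus_rep_completely_positive)

section \<open>From the Choi matrix to Kraus operators\<close>

definition unit_mat :: "nat \<Rightarrow> nat \<Rightarrow> nat \<Rightarrow> complex mat" where
  "unit_mat n i j = mat n n (\<lambda>(p, q). if p = i \<and> q = j then 1 else 0)"

lemma unit_mat_carrier [simp]: "unit_mat n i j \<in> carrier_mat n n"
  by (simp add: unit_mat_def)

text \<open>\<open>linear_op\<close> speaks of two summands only, so the expansion in matrix units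
  is built up by induction over the set of positions where \<open>X\<close> is kept.\<close>

lemma linear_op_expand:
  assumes T: "linear_op n m T" and X: "X \<in> carrier_mat n n" and "b < m" "c < m"
  shows "T X $$ (b, c) = (\<Sum>i<n. \<Sum>j<n. X $$ (i, j) * T (unit_mat n i j) $$ (b, c))"
proof -
  define R where "R S = mat n n (\<lambda>p. if p \<in> S then X $$ p else 0)" for S
  have R [simp]: "R S \<in> carrier_mat n n" for S by (simp add: R_def)
  note lin = T[unfolded linear_op_def]
  have carr: "T Y \<in> carrier_mat m m" if "Y \<in> carrier_mat n n" for Y
    using lin that by blast
  have "T (R S) $$ (b, c) = (\<Sum>(i, j)\<in>S. X $$ (i, j) * T (unit_mat n i j) $$ (b, c))"
    if "finite S" for S
    using that
  proof (induction S rule: finite_induct)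
    case empty
    \<comment> \<open>That \<open>T\<close> maps zero to zero comes from homogeneity with the scalar
      0.\<close>
    have "R {} = 0 \<cdot>\<^sub>m R {}" by (auto simp: R_def intro!: eq_matI)
    then have "T (R {}) = 0 \<cdot>\<^sub>m T (R {})" using lin R by metis
    then have "T (R {}) $$ (b, c) = 0 * T (R {}) $$ (b, c)"
      using assms(3,4) carr[OF R[of "{}"]] by (metis carrier_matD index_smult_mat(1))
    then show ?case by simp
  next
    case (insert p S)
    obtain i j where p: "p = (i, j)" by (cases p)
    have "R (insert p S) = X $$ (i, j) \<cdot>\<^sub>m unit_mat n i j + R S"
      using insert.hyps by (auto simp: R_def unit_mat_def p intro!: eq_matI)
    then have "T (R (insert p S)) = X $$ (i, j) \<cdot>\<^sub>m T (unit_mat n i j) + T (R S)"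
      using lin by simp
    then show ?case
      using insert assms(3,4) carr[of "R S"] carr[of "unit_mat n i j"] by (simp add: p)
  qed
  from this[of "{..<n} \<times> {..<n}"]
  have "T (R ({..<n} \<times> {..<n})) $$ (b, c) =
      (\<Sum>i<n. \<Sum>j<n. X $$ (i, j) * T (unit_mat n i j) $$ (b, c))"
    by (simp add: sum.cartesian_product)
  moreover have "R ({..<n} \<times> {..<n}) = X" using X by (auto simp: R_def)
  ultimately show ?thesis by simp
qed

text \<open>The Kraus operators are the vectors of a factorisation of the Choi matrix of \<open>T\<close>.\<close>

lemma cptp_kraus_rep:
  assumes "cptp n m T"
  shows "\<exists>r K. kraus_rep n m r K T"
proof -
  have lin: "linear_op n m T" and cp: "completely_positive n m T" and tp: "trace_preserving n T"
    using assms by (auto simp: cptp_def)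
  \<comment> \<open>The unnormalised maximally entangled projector. Its block (i, j) is the matrix
    unit E_ij, hence block (i, j) of \<open>C\<close> is T(E_ij) and \<open>C\<close> is the Choi
    matrix.\<close>
  define \<Omega> where "\<Omega> = mat (n * n) (n * n)
    (\<lambda>(x, y). if x div n = x mod n \<and> y div n = y mod n then 1 else 0 :: complex)"
  define C where "C = id_tensor n n m T \<Omega>"
  have "psd (n * n) (\<lambda>x y. \<Omega> $$ (x, y))"
    unfolding psd_def
  proof
    fix v :: "nat \<Rightarrow> complex"
    \<comment> \<open>The overlap of \<open>v\<close> with the sum of the vectors |i>|i>; the form
      at \<open>v\<close> is its squared modulus.\<close>
    define s where "s = (\<Sum>x<n*n. if x div n = x mod n then v x else 0)"
    have "(\<Sum>x<n*n. \<Sum>y<n*n. cnj (v x) * \<Omega> $$ (x, y) * v y) = cnj s * s"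
      unfolding s_def cnj_sum sum_product by (intro sum.cong) (auto simp: \<Omega>_def)
    also have "0 \<le> cnj s * s"
      by (simp add: less_eq_complex_def)
    finally show "0 \<le> (\<Sum>x<n*n. \<Sum>y<n*n. cnj (v x) * \<Omega> $$ (x, y) * v y)" .
  qed
  then have "positive_op (n * n) \<Omega>"
    by (simp add: positive_op_iff_psd \<Omega>_def)
  then have "positive_op (n * m) C"
    using cp by (simp add: completely_positive_def C_def)
  then obtain w where w: "\<And>x y. x < n * m \<Longrightarrow> y < n * m \<Longrightarrow>
      C $$ (x, y) = (\<Sum>k<n*m. w k x * cnj (w k y))"
    unfolding positive_op_iff_psd using psd_factor by blast
  \<comment> \<open>Each factor vector, of length \<open>n * m\<close>, is cut into \<open>n\<close>
    pieces of length \<open>m\<close>, which become the columns of a Kraus operator.\<close>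
  define K where "K k = mat m n (\<lambda>(b, i). w k (i * m + b))" for k
  have unit: "T (unit_mat n i j) $$ (b, c) = (\<Sum>k<n*m. K k $$ (b, i) * cnj (K k $$ (c, j)))"
    if "i < n" "j < n" "b < m" "c < m" for i j b c
  proof -
    have "block n \<Omega> i j = unit_mat n i j"
      using that mult_add_less_mult by (auto simp: block_def unit_mat_def \<Omega>_def intro!: eq_matI)
    then have "C $$ (i * m + b, j * m + c) = T (unit_mat n i j) $$ (b, c)"
      using that mult_add_less_mult by (simp add: C_def id_tensor_def)
    then show ?thesis using w[of "i * m + b" "j * m + c"] that mult_add_less_mult by (simp add: K_def)
  qed
  have "kraus_rep n m (n * m) K T"
    unfolding kraus_rep_iff
  proof (intro conjI ballI allI impI)
    fix i j assume ij: "i < n" "j < n"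
    \<comment> \<open>Entry (i, j) of the completeness sum is the trace of T(E_ji), so completeness
      is trace preservation on matrix units.\<close>
    have "(\<Sum>k<n*m. \<Sum>b<m. cnj (K k $$ (b, i)) * K k $$ (b, j)) =
        (\<Sum>b<m. \<Sum>k<n*m. K k $$ (b, j) * cnj (K k $$ (b, i)))"
      by (subst sum.swap) (simp add: mult.commute)
    also have "\<dots> = mtrace (T (unit_mat n j i))"
    proof -
      have "T (unit_mat n j i) \<in> carrier_mat m m"
        using lin by (simp add: linear_op_def)
      then show ?thesis using ij by (simp add: mtrace_def unit)
    qed
    also have "\<dots> = mtrace (unit_mat n j i)"
      using tp by (simp add: trace_preserving_def)
    also have "\<dots> = (if i = j then 1 else 0)"
      using ij by (auto simp: mtrace_def unit_mat_def intro!: sum.neutral)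
    finally show "(\<Sum>k<n*m. \<Sum>b<m. cnj (K k $$ (b, i)) * K k $$ (b, j)) = (if i = j then 1 else 0)" .
  next
    fix X :: "complex mat" and b c assume X: "X \<in> carrier_mat n n" and bc: "b < m" "c < m"
    have "T X $$ (b, c) = (\<Sum>i<n. \<Sum>j<n. X $$ (i, j) * (\<Sum>k<n*m. K k $$ (b, i) * cnj (K k $$ (c, j))))"
      using bc by (simp add: linear_op_expand[OF lin X bc] unit)
    also have "\<dots> = (\<Sum>i<n. \<Sum>j<n. \<Sum>k<n*m. K k $$ (b, i) * X $$ (i, j) * cnj (K k $$ (c, j)))"
      by (simp add: sum_distrib_left mult_ac)
    also have "\<dots> = (\<Sum>k<n*m. \<Sum>i<n. \<Sum>j<n. K k $$ (b, i) * X $$ (i, j) * cnj (K k $$ (c, j)))"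
      by (simp add: sum.swap[of _ "{..<n*m}"])
    finally show "T X $$ (b, c) = \<dots>" .
  next
    fix X :: "complex mat" assume X: "X \<in> carrier_mat n n"
    then show "T X \<in> carrier_mat m m" using lin by (simp add: linear_op_def)
  qed (simp add: K_def)
  then show ?thesis by blast
qed

subsection \<open>Implementation with the maximally coherent state\<close>

text \<open>A column with at most one nonzero entry means that a basis vector goes to a multiple of
  a basis vector, so a mixture of basis states stays diagonal.\<close>

lemma incoherent_operator_if_columns:
  assumes "K \<in> carrier_mat m n"
    and col: "\<And>b c x. \<lbrakk>b < m; c < m; x < n; b \<noteq> c\<rbrakk> \<Longrightarrow> K $$ (b, x) = 0 \<or> K $$ (c, x) = 0"
  shows "incoherent_operator n m K"
  unfolding incoherent_operator_def
proof (intro conjI allI impI)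
  fix \<delta> assume "incoherent_state n \<delta>"
  then have \<delta>: "\<delta> \<in> carrier_mat n n" and diag: "diagonal_mat \<delta>"
    by (auto simp: incoherent_state_def state_def positive_op_def)
  show "diagonal_mat (K * \<delta> * mat_adjoint K)"
    unfolding diagonal_mat_def
  proof (intro allI impI)
    fix b c assume "b < dim_row (K * \<delta> * mat_adjoint K)" "c < dim_col (K * \<delta> * mat_adjoint K)"
      and ne: "b \<noteq> c"
    then have bc: "b < m" "c < m" using assms(1) by auto
    \<comment> \<open>For \<open>i \<noteq> j\<close> the entry of \<open>\<delta>\<close> vanishes,
      for \<open>i = j\<close> one of the two entries in column \<open>i\<close> of
      \<open>K\<close>.\<close>
    have "K $$ (b, i) * \<delta> $$ (i, j) * cnj (K $$ (c, j)) = 0" if "i < n" "j < n" for i j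
      using col[OF bc that(1) ne] diag \<delta> that by (cases "i = j") (auto simp: diagonal_mat_def)
    then show "(K * \<delta> * mat_adjoint K) $$ (b, c) = 0"
      unfolding sandwich_index[OF assms(1) \<delta> bc] by (intro sum.neutral ballI) auto
  qed
qed (rule assms)

section \<open>Cyclic shifts modulo d\<close>

lemma add_mod_left_inj:
  fixes b c k d :: nat
  assumes "b < d" "c < d" "(b + k) mod d = (c + k) mod d"
  shows "b = c"
  using assms
\<comment> \<open>With b \<le> c the subtraction is not truncated, and \<open>d\<close> divides the
  number c - b, which is less than \<open>d\<close>.\<close>
proof (induction b c rule: linorder_wlog)
  case (le b c)
  then have "d dvd (c + k) - (b + k)"
    using mod_eq_dvd_iff_nat[of "b + k" "c + k" d] by simp
  then show ?case using le by (auto dest: dvd_imp_le)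
qed simp

text \<open>Exactly one shift carries \<open>b\<close> to \<open>l\<close>. This is the resolution
  of the identity by the shifted basis vectors.\<close>

lemma sum_cyclic_shift:
  fixes l b d :: nat
  assumes "l < d" "b < d"
  shows "(\<Sum>k<d. if l = (b + k) mod d then z else 0) = (z :: complex)"
proof -
  \<comment> \<open>\<open>d - b\<close> stands for -b modulo \<open>d\<close> and keeps the
    solution a natural number.\<close>
  define k0 where "k0 = (l + (d - b)) mod d"
  have "l = (b + k) mod d \<longleftrightarrow> k = k0" if "k < d" for k
  proof
    have *: "(b + k0) mod d = l"
      using assms by (simp add: k0_def mod_simps)
    show "l = (b + k) mod d" if "k = k0" using * that by simp
    show "k = k0" if "l = (b + k) mod d"
      using * that \<open>k < d\<close> assms
      by (intro add_mod_left_inj[of k d k0 b]) (auto simp: k0_def add.commute)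
  qed
  then have "(\<Sum>k<d. if l = (b + k) mod d then z else 0) = (\<Sum>k<d. if k = k0 then z else 0)"
    by (intro sum.cong) auto
  then show ?thesis using assms by (simp add: k0_def)
qed

text \<open>All entries of the resource projector equal 1/d, so the ancilla parts of the indices
  drop out.\<close>

lemma kron_max_coherent_index:
  assumes "\<rho> \<in> carrier_mat n n" "x < n * d" "y < n * d"
  shows "kron \<rho> (projector (max_coherent d)) $$ (x, y) = \<rho> $$ (x div d, y div d) / of_nat d"
proof -
  have d: "d > 0" using assms by (cases d) auto
  have "complex_of_real (sqrt d) * complex_of_real (sqrt d) = of_nat d"
    by (simp flip: of_real_mult)
  then show ?thesis
    using assms d by (simp add: kron_def projector_def max_coherent_def)
qed

theorem theorem4:
  fixes T :: "complex mat \<Rightarrow> complex mat" and a d :: nat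
  assumes "cptp a d T"
  shows "\<exists>I. incoherent_operation (a * d) d I \<and>
             (\<forall>\<rho>. state a \<rho> \<longrightarrow> I (kron \<rho> (projector (max_coherent d))) = T \<rho>)"
proof -
  obtain r K where K: "kraus_rep a d r K T"
    using cptp_kraus_rep[OF assms] by blast
  \<comment> \<open>The index \<open>\<beta> = \<alpha> * d + k\<close> encodes the pair of a Kraus
    operator and a shift; \<open>x div d\<close> is the A-part of the column index and
    \<open>x mod d\<close> its ancilla level.\<close>
  define M where "M \<beta> = mat d (a * d) (\<lambda>(b, x).
    if x mod d = (b + \<beta> mod d) mod d then K (\<beta> div d) $$ (b, x div d) else 0)" for \<beta>
  define I where "I X = mat_sum d (r * d) (\<lambda>\<beta>. M \<beta> * X * mat_adjoint (M \<beta>))" for X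
  have M [simp]: "M \<beta> \<in> carrier_mat d (a * d)" for \<beta> by (simp add: M_def)
  have "mat_sum (a * d) (r * d) (\<lambda>\<beta>. mat_adjoint (M \<beta>) * M \<beta>) = 1\<^sub>m (a * d)"
  proof (rule eq_matI)
    fix x y assume "x < dim_row (1\<^sub>m (a * d))" "y < dim_col (1\<^sub>m (a * d))"
    then have xy: "x < a * d" "y < a * d" by auto
    then have d: "d > 0" by (cases d) auto
    have div: "x div d < a" "y div d < a" using xy by (auto simp: less_mult_imp_div_less)
    have "mat_sum (a * d) (r * d) (\<lambda>\<beta>. mat_adjoint (M \<beta>) * M \<beta>) $$ (x, y) =
        (\<Sum>\<beta><r*d. \<Sum>b<d. cnj (M \<beta> $$ (b, x)) * M \<beta> $$ (b, y))"
      using xy by (simp add: mat_sum_def adjoint_mult_index[OF M] del: index_mult_mat)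
    \<comment> \<open>The shift conditions on \<open>x\<close> and on \<open>y\<close> hold together
      iff the first holds and the ancilla levels agree.\<close>
    also have "\<dots> = (\<Sum>\<alpha><r. \<Sum>k<d. \<Sum>b<d. if x mod d = (b + k) mod d then
        (if x mod d = y mod d then cnj (K \<alpha> $$ (b, x div d)) * K \<alpha> $$ (b, y div d) else 0) else 0)"
      unfolding sum_lessThan_mult using xy by (intro sum.cong) (auto simp: M_def)
    \<comment> \<open>With the sums over \<open>k\<close> and \<open>b\<close> exchanged, a single
      shift survives for each \<open>b\<close>.\<close>
    also have "\<dots> = (\<Sum>\<alpha><r. \<Sum>b<d. if x mod d = y mod d then
        cnj (K \<alpha> $$ (b, x div d)) * K \<alpha> $$ (b, y div d) else 0)"
      using d by (subst sum.swap[of _ "{..<d}" "{..<d}"]) (simp add: sum_cyclic_shift)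
    also have "\<dots> = (if x mod d = y mod d then if x div d = y div d then 1 else 0 else 0)"
      using K div by (auto simp: kraus_rep_iff)
    also have "\<dots> = 1\<^sub>m (a * d) $$ (x, y)"
      using xy by simp (metis div_mult_mod_eq)
    finally show "mat_sum (a * d) (r * d) (\<lambda>\<beta>. mat_adjoint (M \<beta>) * M \<beta>) $$ (x, y) = 1\<^sub>m (a * d) $$ (x, y)" .
  qed (auto simp: mat_sum_def)
  then have krausI: "kraus_rep (a * d) d (r * d) M I"
    by (simp add: kraus_rep_def I_def)
  have "incoherent_operator (a * d) d (M \<beta>)" for \<beta>
  proof (rule incoherent_operator_if_columns[OF M])
    fix b c x assume "b < d" "c < d" "x < a * d" "b \<noteq> c"
    \<comment> \<open>If both entries were nonzero, \<open>b\<close> and \<open>c\<close> would be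
      shifted to the same level \<open>x mod d\<close>.\<close>
    then show "M \<beta> $$ (b, x) = 0 \<or> M \<beta> $$ (c, x) = 0"
      using add_mod_left_inj[of b d c "\<beta> mod d"] by (auto simp: M_def)
  qed
  then have "incoherent_operation (a * d) d I"
    using krausI kraus_rep_cptp unfolding incoherent_operation_def by blast
  moreover have "I (kron \<rho> (projector (max_coherent d))) = T \<rho>" if "state a \<rho>" for \<rho>
  proof -
    let ?X = "kron \<rho> (projector (max_coherent d))"
    have \<rho>: "\<rho> \<in> carrier_mat a a" using that by (simp add: state_def positive_op_def)
    then have X: "?X \<in> carrier_mat (a * d) (a * d)"
      by (simp add: kron_def projector_def max_coherent_def)
    have T: "T \<rho> \<in> carrier_mat d d" using K \<rho> by (simp add: kraus_rep_iff)
    show ?thesis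
    proof (rule eq_matI)
      fix b c assume "b < dim_row (T \<rho>)" "c < dim_col (T \<rho>)"
      then have bc: "b < d" "c < d" using T by auto
      then have d: "d > 0" by simp
      \<comment> \<open>Against a function of the A-part alone, only the ancilla level (e + k) mod d
        contributes, and the result does not depend on \<open>k\<close>.\<close>
      have M_sum: "(\<Sum>x<a*d. M (\<alpha> * d + k) $$ (e, x) * g (x div d)) =
          (\<Sum>i<a. K \<alpha> $$ (e, i) * g i)" if "e < d" "k < d" for \<alpha> k e g
      proof -
        have "(\<Sum>x<a*d. M (\<alpha> * d + k) $$ (e, x) * g (x div d)) =
            (\<Sum>i<a. \<Sum>l<d. if l = (e + k) mod d then K \<alpha> $$ (e, i) * g i else 0)"
          unfolding sum_lessThan_mult using that by (intro sum.cong) (auto simp: M_def mult_add_less_mult)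
        then show ?thesis using d by simp
      qed
      have "I ?X $$ (b, c) =
          (\<Sum>\<beta><r*d. \<Sum>x<a*d. \<Sum>y<a*d. M \<beta> $$ (b, x) * ?X $$ (x, y) * cnj (M \<beta> $$ (c, y)))"
        using krausI X bc by (simp add: kraus_rep_iff)
      also have "\<dots> = (\<Sum>\<beta><r*d. \<Sum>x<a*d. M \<beta> $$ (b, x) *
          cnj (\<Sum>y<a*d. M \<beta> $$ (c, y) * cnj (\<rho> $$ (x div d, y div d) / of_nat d)))"
        by (simp add: kron_max_coherent_index[OF \<rho>] sum_distrib_left mult_ac)
      also have "\<dots> = (\<Sum>\<alpha><r. \<Sum>k<d. \<Sum>i<a. K \<alpha> $$ (b, i) *
          cnj (\<Sum>j<a. K \<alpha> $$ (c, j) * cnj (\<rho> $$ (i, j) / of_nat d)))"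
        unfolding sum_lessThan_mult[of _ r d]
      proof (intro sum.cong[of "{..<r}"] sum.cong[of "{..<d}"] refl)
        fix \<alpha> k assume "k \<in> {..<d}"
        then have k: "k < d" by simp
        show "(\<Sum>x<a*d. M (\<alpha> * d + k) $$ (b, x) *
            cnj (\<Sum>y<a*d. M (\<alpha> * d + k) $$ (c, y) * cnj (\<rho> $$ (x div d, y div d) / of_nat d))) =
          (\<Sum>i<a. K \<alpha> $$ (b, i) * cnj (\<Sum>j<a. K \<alpha> $$ (c, j) * cnj (\<rho> $$ (i, j) / of_nat d)))"
          unfolding M_sum[OF bc(2) k, of \<alpha> "\<lambda>l. cnj (\<rho> $$ (i, l) / of_nat d)" for i]
          by (rule M_sum[OF bc(1) k])
      qed
      \<comment> \<open>The summand is the same for all \<open>d\<close> shifts, which cancels the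
        factor 1/d of the resource state.\<close>
      also have "\<dots> = (\<Sum>\<alpha><r. \<Sum>i<a. \<Sum>j<a. K \<alpha> $$ (b, i) * \<rho> $$ (i, j) * cnj (K \<alpha> $$ (c, j)))"
        using d by (simp add: sum_distrib_left mult_ac)
      also have "\<dots> = T \<rho> $$ (b, c)"
        using K \<rho> bc by (simp add: kraus_rep_iff)
      finally show "I ?X $$ (b, c) = T \<rho> $$ (b, c)" .
    qed (use T in \<open>auto simp: I_def mat_sum_def\<close>)
  qed
  ultimately show ?thesis by blast
qed

end
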